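(* Let $m, n$ be positive integers. For every integer $k \geq (-1)^{n-1} f_{n-2}(m) + 1$ put $$s = (-1)^n f_n(m) f_{n-1}(m) + k f_{n+1}(m), \qquad t = (-1)^{n-1} f_{n-1}(m)^2 - k f_n(m).$$ Then $s$ is a positive integer, and the number $\alpha = [0; \overline{m, \ldots, m, s}]$, whose period consists of $n$ copies of $m$ followed by $s$ (so has length $n+1$), is an algebraic integer with minimal polynomial $x^2 + sx + t$. In particular there are infinitely many values of $s$ (depending on $m,n$) for which $[0;\overline{m,\ldots,m,s}]$ is an algebraic integer.
   Context: The Fibonacci polynomials $f_h(m)$, for a fixed integer $m$, are defined by $f_0(m) = 0$, $f_1(m) = 1$, $f_h(m) = m f_{h-1}(m) + f_{h-2}(m)$ for $h \geq 2$, and for negative indices by $f_{-h}(m) = (-1)^{h-1} f_h(m)$ for $h \geq 1$. $[b_0; b_1, b_2, \ldots]$ denotes the simple continued fraction $b_0 + 1/(b_1 + 1/(b_2 + \cdots))$ and an overline denotes a periodically repeated block. *)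

theory Defs
  imports Complex_Main "HOL-Computational_Algebra.Polynomial"
begin

fun fib_poly_nat :: "int \<Rightarrow> nat \<Rightarrow> int" where
  "fib_poly_nat m 0 = 0"
| "fib_poly_nat m (Suc 0) = 1"
| "fib_poly_nat m (Suc (Suc h)) = m * fib_poly_nat m (Suc h) + fib_poly_nat m h"

(* In the second branch h = -j with j = nat (- h) >= 1, so the exponent j - 1 does not truncate. *)
definition fib_poly :: "int \<Rightarrow> int \<Rightarrow> int" where
  "fib_poly m h =
     (if 0 \<le> h then fib_poly_nat m (nat h)
      else (-1) ^ (nat (- h) - 1) * fib_poly_nat m (nat (- h)))"

(* cfrac_conv b N = [b 0; b 1, ..., b N] *)
fun cfrac_conv :: "(nat \<Rightarrow> int) \<Rightarrow> nat \<Rightarrow> real" where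
  "cfrac_conv b 0 = real_of_int (b 0)"
| "cfrac_conv b (Suc N) = real_of_int (b 0) + 1 / cfrac_conv (\<lambda>i. b (Suc i)) N"

definition has_cfrac :: "real \<Rightarrow> (nat \<Rightarrow> int) \<Rightarrow> bool" where
  "has_cfrac x b \<longleftrightarrow> cfrac_conv b \<longlonglongrightarrow> x"

(* The partial quotients of the purely periodic tail expansion [a; overline(bs)], for bs nonempty. *)
definition periodic_quotients :: "int \<Rightarrow> int list \<Rightarrow> nat \<Rightarrow> int" where
  "periodic_quotients a bs i = (if i = 0 then a else bs ! ((i - 1) mod length bs))"

definition is_min_poly_rat :: "rat poly \<Rightarrow> real \<Rightarrow> bool" where
  "is_min_poly_rat p x \<longleftrightarrow>
     lead_coeff p = 1 \<and> poly (map_poly of_rat p) x = 0 \<and>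
     (\<forall>q :: rat poly. q \<noteq> 0 \<and> poly (map_poly of_rat q) x = 0 \<longrightarrow> degree p \<le> degree q)"

end

theory Submission
  imports Defs
begin

text \<open>
  With \<open>\<beta> = s + \<alpha>\<close>, unfolding one period turns \<open>\<alpha> = [0; m, \<dots>, m, \<beta>]\<close> into
  \<open>\<alpha> = (f\<^sub>n \<beta> + f\<^sub>n\<^sub>-\<^sub>1) / (f\<^sub>n\<^sub>+\<^sub>1 \<beta> + f\<^sub>n)\<close>, that is
  \<open>f\<^sub>n\<^sub>+\<^sub>1 (\<alpha>\<^sup>2 + s \<alpha>) = f\<^sub>n s + f\<^sub>n\<^sub>-\<^sub>1\<close>. By Cassini's identity the
  special shape of \<open>s\<close> is what makes the right-hand side divisible by \<open>f\<^sub>n\<^sub>+\<^sub>1\<close>, with quotient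
  \<open>-t\<close>. Conversely \<open>x\<^sup>2 + s x + t\<close> changes sign on \<open>(0, 1)\<close>; its root there has the required
  expansion, and being an algebraic integer strictly between two consecutive integers it is
  irrational.
\<close>

section \<open>Convergence of continued fractions from complete quotients\<close>

lemma cfrac_conv_ge_1:
  assumes "\<And>i. 1 \<le> b i"
  shows "1 \<le> cfrac_conv b N"
  using assms
proof (induction N arbitrary: b)
  case 0
  then show ?case by simp
next
  case (Suc N)
  have "1 \<le> cfrac_conv (\<lambda>i. b (Suc i)) N"
    by (rule Suc.IH) (rule Suc.prems)
  then have "0 \<le> 1 / cfrac_conv (\<lambda>i. b (Suc i)) N"
    by simp
  moreover have "1 \<le> real_of_int (b 0)"
    using Suc.prems by simp
  ultimately show ?case
    unfolding cfrac_conv.simps by linarith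
qed

text \<open>Removing one partial quotient divides the error by a product only known to be at least
  1, so a single step need not contract. Two steps together divide it by at least 2, whence the
  exponent \<open>N div 2\<close>, the induction in steps of two and the two base cases.\<close>

lemma cfrac_conv_error:
  assumes "\<And>i. x i = real_of_int (b i) + 1 / x (Suc i)"
    and "\<And>i. 1 \<le> x (Suc i)" and "\<And>i. 1 \<le> b (Suc i)"
  shows "\<bar>cfrac_conv b N - x 0\<bar> \<le> (1 / 2) ^ (N div 2)"
  using assms
proof (induction N arbitrary: b x rule: less_induct)
  case (less N)
  have inv_diff: "\<bar>1 / u - 1 / v\<bar> = \<bar>u - v\<bar> / (u * v)" if "1 \<le> u" "1 \<le> v" for u v :: real
  proof -
    have "1 / u - 1 / v = (v - u) / (u * v)"
      using that by (simp add: field_simps)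
    then show ?thesis
      using that by (simp add: abs_mult abs_minus_commute)
  qed
  note x_eq = less.prems(1) and x_ge = less.prems(2) and b_ge = less.prems(3)
  consider "N = 0" | "N = 1" | M where "N = Suc (Suc M)"
    by (metis One_nat_def not0_implies_Suc)
  then show ?case
  proof cases
    case 1
    then show ?thesis
      using x_eq[of 0] x_ge[of 0] by simp
  next
    case 2
    have b1: "1 \<le> real_of_int (b 1)"
      using b_ge[of 0] by simp
    have x1: "1 \<le> x 1"
      using x_ge[of 0] by simp
    have "cfrac_conv b N - x 0 = 1 / b 1 - 1 / x 1"
      using 2 x_eq[of 0] by simp
    moreover have "\<bar>1 / b 1 - 1 / x 1\<bar> \<le> 1"
    proof -
      have "0 \<le> 1 / real_of_int (b 1)" "1 / real_of_int (b 1) \<le> 1" "0 \<le> 1 / x 1" "1 / x 1 \<le> 1"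
        using b1 x1 by simp_all
      then show ?thesis by linarith
    qed
    ultimately show ?thesis
      using 2 by simp
  next
    case 3
    define c1 where "c1 = cfrac_conv (\<lambda>i. b (Suc i)) (Suc M)"
    define c2 where "c2 = cfrac_conv (\<lambda>i. b (Suc (Suc i))) M"
    have c: "1 \<le> c1" "1 \<le> c2"
      unfolding c1_def c2_def using b_ge by (intro cfrac_conv_ge_1; simp)+
    have x: "1 \<le> x 1" "1 \<le> x 2"
      using x_ge[of 0] x_ge[of 1] by (simp_all add: numeral_2_eq_2)
    have "\<bar>c2 - x (Suc (Suc 0))\<bar> \<le> (1 / 2) ^ (M div 2)"
      unfolding c2_def
      by (rule less.IH[of M "\<lambda>i. x (Suc (Suc i))" "\<lambda>i. b (Suc (Suc i))"])
        (use 3 in simp, rule x_eq, rule x_ge, rule b_ge)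
    then have IH: "\<bar>c2 - x 2\<bar> \<le> (1 / 2) ^ (M div 2)"
      by (simp add: numeral_2_eq_2)
    \<comment> \<open>The exact relation between consecutive complete quotients supplies the factor
      2: it forces \<open>x 1 * x 2\<close> to be at least 2 even when both are close to 1.\<close>
    have "x 1 * x 2 = b 1 * x 2 + 1"
      using x_eq[of 1] x(2) by (simp add: field_simps numeral_2_eq_2)
    moreover have "1 * 1 \<le> real_of_int (b 1) * x 2"
      using b_ge[of 0] x by (intro mult_mono) auto
    ultimately have x12: "2 \<le> x 1 * x 2"
      by simp
    have cc: "1 * 1 \<le> c1 * c2"
      using c by (intro mult_mono) auto
    have "1 * 2 \<le> (c1 * c2) * (x 1 * x 2)"
      using cc x12 by (intro mult_mono) auto
    then have ge2: "2 \<le> (c2 * x 2) * (c1 * x 1)"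
      by (simp add: mult_ac)
    have "cfrac_conv b N - x 0 = 1 / c1 - 1 / x 1"
      using 3 x_eq[of 0] by (simp add: c1_def)
    then have "\<bar>cfrac_conv b N - x 0\<bar> = \<bar>c1 - x 1\<bar> / (c1 * x 1)"
      using inv_diff c x by simp
    also have "c1 - x 1 = 1 / c2 - 1 / x 2"
      using x_eq[of 1] by (simp add: c1_def c2_def numeral_2_eq_2)
    also have "\<bar>1 / c2 - 1 / x 2\<bar> / (c1 * x 1) = \<bar>c2 - x 2\<bar> / ((c2 * x 2) * (c1 * x 1))"
      using inv_diff c x by simp
    also have "\<dots> \<le> (1 / 2) ^ (M div 2) / 2"
      using IH ge2 by (intro frac_le) auto
    finally show ?thesis
      using 3 by simp
  qed
qed

text \<open>The error bound tends to 0, so an expansion can be verified by exhibiting its complete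
  quotients \<open>x i\<close>, with no separate study of convergents.\<close>

lemma has_cfrac_if_complete_quotients:
  assumes "\<And>i. x i = real_of_int (b i) + 1 / x (Suc i)"
    and "\<And>i. 1 \<le> x (Suc i)" and "\<And>i. 1 \<le> b (Suc i)"
  shows "has_cfrac (x 0) b"
proof -
  have "filterlim (\<lambda>N::nat. N div 2) sequentially sequentially"
    by (rule filterlim_at_top_div_const_nat) simp
  then have "(\<lambda>N. (1 / 2 :: real) ^ (N div 2)) \<longlonglongrightarrow> 0"
    by (rule filterlim_compose[rotated]) (rule LIMSEQ_power_zero, simp)
  moreover have "norm (cfrac_conv b N - x 0) \<le> norm ((1 / 2 :: real) ^ (N div 2)) * 1" for N
    using cfrac_conv_error[of x b N, OF assms] by simp
  ultimately have "(\<lambda>N. cfrac_conv b N - x 0) \<longlonglongrightarrow> 0"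
    by (rule tendsto_0_le[OF _ always_eventually[OF allI]])
  then show ?thesis
    unfolding has_cfrac_def by (rule LIM_zero_cancel)
qed

section \<open>Fibonacci polynomials\<close>

lemma fib_poly_nat_nonneg: "0 < m \<Longrightarrow> 0 \<le> fib_poly_nat m h"
  by (induction m h rule: fib_poly_nat.induct) auto

lemma fib_poly_nat_pos: "0 < m \<Longrightarrow> 0 < fib_poly_nat m (Suc h)"
  by (induction h) (auto intro!: add_pos_nonneg fib_poly_nat_nonneg)

text \<open>Cassini's identity: one step of the recurrence flips the sign of the left-hand
  side.\<close>

lemma fib_poly_nat_cassini:
  "fib_poly_nat m (Suc (Suc h)) * fib_poly_nat m h - (fib_poly_nat m (Suc h))\<^sup>2 = (-1) ^ Suc h"
proof (induction h)
  case (Suc h)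
  have "fib_poly_nat m (Suc (Suc (Suc h))) * fib_poly_nat m (Suc h)
      - (fib_poly_nat m (Suc (Suc h)))\<^sup>2
    = - (fib_poly_nat m (Suc (Suc h)) * fib_poly_nat m h - (fib_poly_nat m (Suc h))\<^sup>2)"
    by (simp add: power2_eq_square algebra_simps)
  with Suc show ?case by simp
qed simp

lemma fib_poly_of_nat: "fib_poly m (int h) = fib_poly_nat m h"
  by (simp add: fib_poly_def)

text \<open>The recurrence solved backwards. The case \<open>h = 0\<close> reaches index -1, which
  the lower bound on \<open>k\<close> needs when \<open>n = 1\<close>.\<close>

lemma fib_poly_minus_1:
  "fib_poly m (int h - 1) = fib_poly_nat m (Suc h) - m * fib_poly_nat m h"
proof (cases h)
  case (Suc j)
  then show ?thesis
    using fib_poly_of_nat[of m j] by simp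
qed (simp add: fib_poly_def)

section \<open>Quadratic irrationals and algebraic integers\<close>

text \<open>A nonzero rational polynomial of degree at most 1 vanishing at \<alpha> would make
  \<alpha> rational.\<close>

lemma is_min_poly_rat_quadratic:
  fixes p q :: rat and \<alpha> :: real
  assumes root: "\<alpha>\<^sup>2 + of_rat p * \<alpha> + of_rat q = 0" and irrational: "\<alpha> \<notin> \<rat>"
  shows "is_min_poly_rat [:q, p, 1:] \<alpha>"
  unfolding is_min_poly_rat_def
proof (intro conjI allI impI)
  show "poly (map_poly of_rat [:q, p, 1:]) \<alpha> = 0"
    using root by (simp add: map_poly_pCons power2_eq_square algebra_simps)
next
  fix r :: "rat poly"
  assume r: "r \<noteq> 0 \<and> poly (map_poly of_rat r) \<alpha> = 0"
  have False if deg: "degree r \<le> 1"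
  proof -
    define a c where "a = coeff r 0" and "c = coeff r 1"
    have r_eq: "r = [:a, c:]"
      using deg unfolding a_def c_def
      by (intro poly_eqI) (auto simp: coeff_pCons coeff_eq_0 split: nat.split)
    have eq: "of_rat a + of_rat c * \<alpha> = 0"
      using r by (simp add: r_eq map_poly_pCons mult.commute)
    have "c \<noteq> 0"
      using eq r r_eq by auto
    then have "\<alpha> = of_rat (- a / c)"
      using eq by (simp add: of_rat_minus of_rat_divide field_simps)
    then show False
      using irrational by simp
  qed
  then show "degree [:q, p, 1:] \<le> degree r"
    by force
qed simp

lemma algebraic_int_quadratic:
  fixes p q :: int and \<alpha> :: real
  assumes "\<alpha>\<^sup>2 + of_int p * \<alpha> + of_int q = 0"
  shows "algebraic_int \<alpha>"
proof (rule algebraic_int.intros)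
  show "poly [:of_int q, of_int p, 1:] \<alpha> = 0"
    using assms by (simp add: power2_eq_square algebra_simps)
  show "\<forall>i. coeff [:of_int q, of_int p, 1 :: real:] i \<in> \<int>"
    by (auto simp: coeff_pCons split: nat.split)
qed simp

section \<open>Purely periodic tails as fixed points\<close>

text \<open>The map is the Moebius transformation with matrix rows \<open>(m, 1)\<close> and
  \<open>(1, 0)\<close>, whose powers have Fibonacci polynomials as entries.\<close>

lemma iterate_fib_poly_nat:
  fixes m :: int and \<beta> :: real
  assumes "0 < m" and "0 < \<beta>"
  shows "((\<lambda>y. m + 1 / y) ^^ Suc h) \<beta> =
    (fib_poly_nat m (Suc (Suc h)) * \<beta> + fib_poly_nat m (Suc h)) /
    (fib_poly_nat m (Suc h) * \<beta> + fib_poly_nat m h)"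
proof (induction h)
  case 0
  show ?case
    using assms by (simp add: field_simps)
next
  case (Suc h)
  have "0 < fib_poly_nat m (Suc (Suc h)) * \<beta> + fib_poly_nat m (Suc h)"
    using assms fib_poly_nat_pos[OF assms(1)]
    by (intro add_pos_pos mult_pos_pos) (simp_all del: fib_poly_nat.simps)
  then show ?case
    unfolding funpow.simps(2)[of "Suc h"] comp_apply Suc.IH
    by (simp add: field_simps)
qed

lemma has_cfrac_periodic:
  fixes m s :: int and n :: nat and \<alpha> :: real
  assumes "0 < m" and "0 < s" and "0 < \<alpha>"
    and fixed_point: "\<alpha> * ((\<lambda>y. m + 1 / y) ^^ n) (s + \<alpha>) = 1"
  shows "has_cfrac \<alpha> (periodic_quotients 0 (replicate n m @ [s]))"
proof -
  define z where "z j = ((\<lambda>y. m + 1 / y) ^^ j) (s + \<alpha>)" for j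
  \<comment> \<open>The iterates \<open>z\<close> run backwards through the period:
    \<open>z n\<close> stands at its first place, and \<open>z 0\<close>, the complete quotient
    beginning with \<open>s\<close>, at its last.\<close>
  define x where "x i = (if i = 0 then \<alpha> else z (n - (i - 1) mod Suc n))" for i
  define b where "b = periodic_quotients 0 (replicate n m @ [s])"
  have z_0: "z 0 = s + \<alpha>" and z_Suc: "z (Suc j) = m + 1 / z j" for j
    by (simp_all add: z_def)
  have z_ge: "1 \<le> z j" for j
  proof (induction j)
    case 0
    show ?case using assms z_0 by simp
  next
    case (Suc j)
    then have "0 < 1 / z j" by simp
    moreover have "1 \<le> real_of_int m" using assms by simp
    ultimately show ?case unfolding z_Suc by linarith
  qed
  have \<alpha>_eq: "\<alpha> = 1 / z n"
    using fixed_point z_ge[of n] by (simp add: z_def field_simps)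
  have b_Suc: "b (Suc i) = (if i mod Suc n = n then s else m)" for i
  proof -
    have "i mod Suc n < Suc n" by simp
    then show ?thesis
      by (auto simp: b_def periodic_quotients_def nth_append simp del: mod_less_divisor)
  qed
  have "has_cfrac (x 0) b"
  proof (rule has_cfrac_if_complete_quotients)
    fix i
    show "x i = b i + 1 / x (Suc i)"
    proof (cases i)
      case 0
      then show ?thesis
        using \<alpha>_eq by (simp add: x_def b_def periodic_quotients_def)
    next
      case (Suc j)
      show ?thesis
      proof (cases "j mod Suc n = n")
        case True
        \<comment> \<open>The period wraps around here: \<open>z 0 = s + \<alpha>\<close> and
          \<open>\<alpha> = 1 / z n\<close> give the required relation.\<close>
        then have "Suc j mod Suc n = 0" by (simp add: mod_Suc)
        then show ?thesis
          using Suc True \<alpha>_eq z_0 by (simp add: x_def b_Suc)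
      next
        case False
        then have "Suc j mod Suc n = Suc (j mod Suc n)" by (simp add: mod_Suc)
        moreover have "j mod Suc n < n"
          using False mod_less_divisor[of "Suc n" j] by linarith
        ultimately have "n - j mod Suc n = Suc (n - Suc j mod Suc n)" by linarith
        then show ?thesis
          using Suc False z_Suc by (simp add: x_def b_Suc)
      qed
    qed
    show "1 \<le> x (Suc i)"
      using z_ge by (simp add: x_def)
    show "1 \<le> b (Suc i)"
      using assms by (simp add: b_Suc)
  qed
  then show ?thesis
    by (simp add: x_def b_def)
qed

section \<open>From the quadratic equation to the expansion\<close>

lemma quadratic_root_in_unit_interval:
  fixes s t :: real
  assumes "t < 0" and "0 < 1 + s + t"
  obtains \<alpha> where "0 < \<alpha>" and "\<alpha> < 1" and "\<alpha>\<^sup>2 + s * \<alpha> + t = 0"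
proof -
  have "\<exists>\<alpha>\<ge>0. \<alpha> \<le> 1 \<and> \<alpha>\<^sup>2 + s * \<alpha> + t = 0"
    using assms by (intro IVT') (auto intro!: continuous_intros)
  then obtain \<alpha> where "0 \<le> \<alpha>" "\<alpha> \<le> 1" and root: "\<alpha>\<^sup>2 + s * \<alpha> + t = 0"
    by blast
  moreover have "\<alpha> \<noteq> 0" "\<alpha> \<noteq> 1"
    using root assms by auto
  ultimately show thesis
    using that[of \<alpha>] by simp
qed

text \<open>The parameter \<open>k\<close> is absent: all that is asked of a positive
  \<open>s\<close> is the divisibility recorded by \<open>t_eq\<close>, with \<open>- t\<close> as
  the quotient.\<close>

lemma periodic_cfrac_quadratic:
  fixes m s t :: int and h :: nat
  assumes "0 < m" and "0 < s"
    and t_eq: "fib_poly_nat m (Suc (Suc h)) * t =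
      - (fib_poly_nat m (Suc h) * s + fib_poly_nat m h)"
  obtains \<alpha> :: real where "has_cfrac \<alpha> (periodic_quotients 0 (replicate (Suc h) m @ [s]))"
    and "algebraic_int \<alpha>" and "is_min_poly_rat [:of_int t, of_int s, 1:] \<alpha>"
proof -
  define A where "A = fib_poly_nat m (Suc (Suc h))"
  define B where "B = fib_poly_nat m (Suc h)"
  define C where "C = fib_poly_nat m h"
  have pos: "0 < A" "0 < B" "0 \<le> C"
    using fib_poly_nat_pos[OF assms(1)] fib_poly_nat_nonneg[OF assms(1)]
    unfolding A_def B_def C_def by blast+
  have A_eq: "A = m * B + C"
    by (simp add: A_def B_def C_def)
  have At: "A * t = - (B * s + C)"
    using t_eq by (simp only: A_def B_def C_def)
  have mB: "B \<le> m * B"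
    using assms(1) pos by simp
  have "0 < B * s + C"
    using pos assms(2) by (simp add: add_pos_nonneg)
  then have "A * t < 0"
    using At by simp
  then have "t < 0"
    using pos by (simp add: mult_less_0_iff)
  \<comment> \<open>The value of the quadratic at 1, multiplied by \<open>A\<close>, is
    \<open>(A - C) + (A - B) * s\<close>, which is positive because \<open>C < A\<close> and
    \<open>B \<le> A\<close>.\<close>
  have "B * s \<le> A * s"
    using mB A_eq pos assms(2) by (intro mult_right_mono) linarith+
  moreover have "C < A"
    using mB A_eq pos by linarith
  ultimately have "0 < A * (1 + s + t)"
    using At by (simp add: distrib_left)
  then have "0 < 1 + s + t"
    using pos by (simp add: zero_less_mult_iff)
  then have "0 < 1 + real_of_int s + real_of_int t"
    by linarith
  then obtain \<alpha> :: real where \<alpha>: "0 < \<alpha>" "\<alpha> < 1" and root: "\<alpha>\<^sup>2 + s * \<alpha> + t = 0"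
    using quadratic_root_in_unit_interval[of t s] \<open>t < 0\<close> by auto
  have alg: "algebraic_int \<alpha>"
    using root by (rule algebraic_int_quadratic)
  have "\<alpha> \<notin> \<rat>"
  proof
    assume "\<alpha> \<in> \<rat>"
    then have "\<alpha> \<in> \<int>"
      using alg rational_algebraic_int_is_int by blast
    then show False
      using \<alpha> by (auto elim!: Ints_cases)
  qed
  then have min_poly: "is_min_poly_rat [:of_int t, of_int s, 1:] \<alpha>"
    using root by (intro is_min_poly_rat_quadratic) simp_all
  define \<beta> where "\<beta> = s + \<alpha>"
  have \<beta>: "0 < \<beta>"
    using \<alpha> assms(2) by (simp add: \<beta>_def)
  have "0 < B * \<beta> + C"
    using pos \<beta> by (intro add_pos_nonneg mult_pos_pos) simp_all
  \<comment> \<open>This is the fixed-point equation cleared of denominators. The left side is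
    \<open>- A * t + \<alpha> * B\<close> plus a multiple of the vanishing quadratic.\<close>
  moreover have "\<alpha> * (A * \<beta> + B) = B * \<beta> + C"
  proof -
    have "real_of_int A * t = - (B * s + C)"
      using At by (metis of_int_mult)
    moreover have "\<alpha> * (A * \<beta> + B) = A * (\<alpha>\<^sup>2 + s * \<alpha> + t) - A * t + \<alpha> * B"
      by (simp add: \<beta>_def power2_eq_square algebra_simps)
    ultimately show ?thesis
      unfolding root by (simp add: \<beta>_def algebra_simps)
  qed
  ultimately have "\<alpha> * ((\<lambda>y. m + 1 / y) ^^ Suc h) \<beta> = 1"
    unfolding iterate_fib_poly_nat[OF assms(1) \<beta>] A_def[symmetric] B_def[symmetric] C_def[symmetric]
    by simp
  then have "has_cfrac \<alpha> (periodic_quotients 0 (replicate (Suc h) m @ [s]))"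
    using assms \<alpha> unfolding \<beta>_def by (intro has_cfrac_periodic)
  then show thesis
    using alg min_poly that by blast
qed

theorem theorem3p1:
  fixes m :: int and n :: nat
  assumes "0 < m" and "0 < n"
  shows "(\<forall>k :: int. (-1) ^ (n - 1) * fib_poly m (int n - 2) + 1 \<le> k \<longrightarrow>
            (let s = (-1) ^ n * fib_poly m (int n) * fib_poly m (int n - 1)
                       + k * fib_poly m (int n + 1);
                 t = (-1) ^ (n - 1) * (fib_poly m (int n - 1))\<^sup>2 - k * fib_poly m (int n)
             in 0 < s \<and>
                (\<exists>\<alpha> :: real. has_cfrac \<alpha> (periodic_quotients 0 (replicate n m @ [s])) \<and>
                   algebraic_int \<alpha> \<and>
                   is_min_poly_rat [:of_int t, of_int s, 1:] \<alpha>)))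
       \<and> infinite {s :: int. 0 < s \<and>
            (\<exists>\<alpha> :: real. has_cfrac \<alpha> (periodic_quotients 0 (replicate n m @ [s])) \<and>
               algebraic_int \<alpha>)}"
    (is "?main \<and> infinite ?S")
proof -
  obtain h where n: "n = Suc h"
    using assms(2) gr0_implies_Suc by blast
  define A where "A = fib_poly_nat m (Suc (Suc h))"
  define B where "B = fib_poly_nat m (Suc h)"
  define C where "C = fib_poly_nat m h"
  define e :: int where "e = (-1) ^ h"
  define k0 where "k0 = e * (B - m * C) + 1"
  define s where "s k = - e * B * C + k * A" for k
  define t where "t k = e * C\<^sup>2 - k * B" for k
  have ee: "e * e = 1"
    by (simp add: e_def flip: power_mult_distrib)
  have cassini: "A * C - B\<^sup>2 = - e"
    using fib_poly_nat_cassini[of m h] by (simp only: A_def B_def C_def e_def) simp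
  have A_eq: "A = m * B + C"
    by (simp add: A_def B_def C_def)
  have A_pos: "0 < A"
    unfolding A_def using fib_poly_nat_pos[OF assms(1)] .
  have f: "fib_poly m (int n) = B" "fib_poly m (int n - 1) = C" "fib_poly m (int n + 1) = A"
    "fib_poly m (int n - 2) = B - m * C"
    using fib_poly_of_nat[of m n] fib_poly_of_nat[of m h] fib_poly_of_nat[of m "Suc n"]
      fib_poly_minus_1[of m h]
    by (simp_all only: n A_def B_def C_def) (simp_all add: add.commute)
  have sgn: "(-1) ^ n = - e" "(-1) ^ (n - 1) = e"
    by (simp_all add: n e_def)
  have quadratic: "0 < s k \<and>
      (\<exists>\<alpha> :: real. has_cfrac \<alpha> (periodic_quotients 0 (replicate n m @ [s k])) \<and>
         algebraic_int \<alpha> \<and> is_min_poly_rat [:of_int (t k), of_int (s k), 1:] \<alpha>)"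
    if k: "k0 \<le> k" for k
  proof -
    \<comment> \<open>Since \<open>s\<close> increases with \<open>k\<close>, positivity need only
      be checked at the lower bound \<open>k0\<close>, where Cassini's identity reduces
      \<open>s\<close> to \<open>A + m\<close>.\<close>
    have "s k0 = A + e * (A * B - m * (A * C) - B * C)"
      by (simp add: s_def k0_def algebra_simps)
    also have "A * B - m * (A * C) - B * C = m * e"
    proof -
      have "A * B - m * (A * C) - B * C = (A - C) * B - m * (A * C)"
        by (simp add: algebra_simps)
      also have "\<dots> = - m * (A * C - B\<^sup>2)"
        by (simp add: A_eq power2_eq_square algebra_simps)
      finally show ?thesis
        using cassini by simp
    qed
    finally have "s k0 = A + m"
      using ee by (simp add: mult.left_commute)
    moreover have "s k0 \<le> s k"
      using k A_pos by (simp add: s_def)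
    ultimately have s_pos: "0 < s k"
      using A_pos assms(1) by linarith
    \<comment> \<open>The terms in \<open>k\<close> cancel, and Cassini's identity turns the rest
      into \<open>- e * e * C + C = 0\<close>.\<close>
    have "A * t k + (B * s k + C) = e * C * (A * C - B\<^sup>2) + C"
      by (simp add: s_def t_def power2_eq_square algebra_simps)
    also have "\<dots> = 0"
      using cassini ee by (simp add: mult.left_commute mult.commute)
    finally have "A * t k = - (B * s k + C)"
      by linarith
    then show ?thesis
      using periodic_cfrac_quadratic[OF assms(1) s_pos, of h "t k"] s_pos
      unfolding A_def B_def C_def n by metis
  qed
  have ?main
    unfolding f sgn Let_def
    using quadratic unfolding s_def t_def k0_def by blast
  moreover have "infinite ?S"
  proof
    assume "finite ?S"
    moreover have "s ` {k0..} \<subseteq> ?S"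
      using quadratic by auto
    \<comment> \<open>As \<open>s\<close> is affine in \<open>k\<close> with slope
      \<open>A > 0\<close>, the infinitely many admissible \<open>k\<close> give distinct
      values.\<close>
    moreover have "inj_on s {k0..}"
      using A_pos by (auto simp: inj_on_def s_def)
    ultimately have "finite {k0..}"
      by (meson finite_subset finite_imageD)
    then show False
      by (simp add: infinite_Ici)
  qed
  ultimately show ?thesis by blast
qed

end
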